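(* Let $c_9\in\mathbb R$. The rotational hypersurface in $\mathbb E_1^4$ parametrized by $$\Gamma^{t}(s,t,w)=\left(c_9,\ -s\cos t\sin w,\ -s\sin t,\ s\cos t\cos w\right),\qquad s\in\mathbb R\setminus\{0\},\ 0\le t,w\le2\pi,$$ has $L_1$-harmonic Gauss map, i.e. its unit normal vector field $N$ satisfies $L_1N=0$.
   Context: $\mathbb E_1^4$ is $\mathbb R^4$ with the Lorentzian metric $\langle\,,\rangle=-dx_1^2+dx_2^2+dx_3^2+dx_4^2$. Let $M$ be an oriented hypersurface of $\mathbb E_1^4$ with nondegenerate induced metric $g$, unit normal vector field (Gauss map) $N$, $\varepsilon=\langle N,N\rangle=\pm1$, shape operator $S=-dN$ and principal curvatures $\kappa_1,\kappa_2,\kappa_3$. Put $a_0=1$, $a_1=-(\kappa_1+\kappa_2+\kappa_3)$, $a_2=\kappa_1\kappa_2+\kappa_1\kappa_3+\kappa_2\kappa_3$, $a_3=-\kappa_1\kappa_2\kappa_3$. The Newton transformations are $P_0=I$, $P_k=a_kI+S\circ P_{k-1}$, and $L_k(\varphi)=\mathrm{tr}(P_k\circ\nabla^2\varphi)$ for $\varphi\in C^\infty(M)$, where $\nabla^2\varphi$ is the Hessian operator of $\varphi$ with respect to $g$; $L_k$ acts componentwise on $\mathbb R^4$-valued functions such as $N$. With $n=3$, $\binom{n}{k}H_k=(-\varepsilon)^ka_k$ and $C_k=\binom{n}{k+1}(-\varepsilon)^k$, the known formula used for the Gauss map is $L_kN=-\varepsilon C_k\big(\nabla H_{k+1}+(nH_1H_{k+1}-(n-k-1)H_{k+2})N\big)$,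 where $\nabla$ is the gradient of $g$. The parametrization is considered where it is an immersion ($\cos t\neq0$). *)

theory Defs
  imports "HOL-Analysis.Analysis"
begin

definition lorentz :: "real ^ 4 \<Rightarrow> real ^ 4 \<Rightarrow> real" where
  "lorentz x y = - (x $ 1 * y $ 1) + x $ 2 * y $ 2 + x $ 3 * y $ 3 + x $ 4 * y $ 4"

text \<open>
  Hypersurfaces are given by a parametrization \<open>X\<close> on a parameter set \<open>U\<close>, and fields along them are
  functions of the parameter. Partial derivatives are taken inside \<open>U\<close>: they are the usual ones at
  interior points, and one-sided where \<open>U\<close> contains boundary points (as \<open>t = 0\<close> or \<open>w = 2 * pi\<close>
  below).
\<close>

definition partial :: "(real ^ 3) set \<Rightarrow> 3 \<Rightarrow> (real ^ 3 \<Rightarrow> 'a::real_normed_vector) \<Rightarrow> real ^ 3 \<Rightarrow> 'a" where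
  "partial U i f u =
     vector_derivative (\<lambda>h. f (u + h *\<^sub>R axis i 1)) (at 0 within {h. u + h *\<^sub>R axis i 1 \<in> U})"

definition induced_metric :: "(real ^ 3) set \<Rightarrow> (real ^ 3 \<Rightarrow> real ^ 4) \<Rightarrow> real ^ 3 \<Rightarrow> real ^ 3 ^ 3" where
  "induced_metric U X u = (\<chi> i j. lorentz (partial U i X u) (partial U j X u))"

text \<open>An invertible Gram matrix also forces the coordinate tangent vectors to be independent.\<close>

definition nondegenerate_immersion :: "(real ^ 3) set \<Rightarrow> (real ^ 3 \<Rightarrow> real ^ 4) \<Rightarrow> bool" where
  "nondegenerate_immersion U X \<longleftrightarrow>
     (\<forall>u\<in>U. X differentiable (at u within U) \<and> invertible (induced_metric U X u))"

definition unit_normal_field ::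
    "(real ^ 3) set \<Rightarrow> (real ^ 3 \<Rightarrow> real ^ 4) \<Rightarrow> (real ^ 3 \<Rightarrow> real ^ 4) \<Rightarrow> bool" where
  "unit_normal_field U X N \<longleftrightarrow>
     continuous_on U N \<and>
     (\<exists>\<epsilon>\<in>{1, -1}. \<forall>u\<in>U. lorentz (N u) (N u) = \<epsilon>) \<and>
     (\<forall>u\<in>U. \<forall>i. lorentz (N u) (partial U i X u) = 0)"

text \<open>
  Operators on tangent spaces are represented by their matrices in the coordinate basis
  \<open>partial U i X u\<close>: column \<open>j\<close> holds the components of the image of the \<open>j\<close>-th basis vector, so
  composition is \<open>**\<close>. The shape operator is \<open>- dN\<close>, read as an endomorphism through the
  differential of \<open>X\<close>.
\<close>

definition shape_operator ::
    "(real ^ 3) set \<Rightarrow> (real ^ 3 \<Rightarrow> real ^ 4) \<Rightarrow> (real ^ 3 \<Rightarrow> real ^ 4) \<Rightarrow> real ^ 3 \<Rightarrow> real ^ 3 ^ 3" where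
  "shape_operator U X N u =
     (THE S. \<forall>j. - partial U j N u = (\<Sum>i\<in>UNIV. S $ i $ j *\<^sub>R partial U i X u))"

text \<open>
  The eigenvalues with algebraic multiplicity, in some order. They are taken in \<open>complex\<close> because a
  shape operator that is self-adjoint for an indefinite metric may have non-real eigenvalues; their
  elementary symmetric functions are real and do not depend on the order.
\<close>

definition principal_curvatures :: "real ^ 3 ^ 3 \<Rightarrow> complex ^ 3" where
  "principal_curvatures S =
     (SOME \<kappa>. \<forall>z. det (mat z - (\<chi> i j. complex_of_real (S $ i $ j))) = (\<Prod>i\<in>UNIV. z - \<kappa> $ i))"

definition newton_coeff :: "nat \<Rightarrow> real ^ 3 ^ 3 \<Rightarrow> real" where
  "newton_coeff k S = Re ((-1) ^ k * (\<Sum>J | card J = k. \<Prod>i\<in>J. principal_curvatures S $ i))"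

primrec newton_transformation :: "nat \<Rightarrow> real ^ 3 ^ 3 \<Rightarrow> real ^ 3 ^ 3" where
  "newton_transformation 0 S = mat 1"
| "newton_transformation (Suc k) S = mat (newton_coeff (Suc k) S) + S ** newton_transformation k S"

definition christoffel ::
    "(real ^ 3) set \<Rightarrow> (real ^ 3 \<Rightarrow> real ^ 4) \<Rightarrow> real ^ 3 \<Rightarrow> 3 \<Rightarrow> 3 \<Rightarrow> 3 \<Rightarrow> real" where
  "christoffel U X u i j l =
     (\<Sum>m\<in>UNIV. matrix_inv (induced_metric U X u) $ i $ m *
        (partial U j (\<lambda>v. induced_metric U X v $ l $ m) u +
         partial U l (\<lambda>v. induced_metric U X v $ j $ m) u -
         partial U m (\<lambda>v. induced_metric U X v $ j $ l) u)) / 2"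

definition gradient ::
    "(real ^ 3) set \<Rightarrow> (real ^ 3 \<Rightarrow> real ^ 4) \<Rightarrow> (real ^ 3 \<Rightarrow> real) \<Rightarrow> real ^ 3 \<Rightarrow> real ^ 3" where
  "gradient U X \<phi> u = matrix_inv (induced_metric U X u) *v (\<chi> l. partial U l \<phi> u)"

text \<open>
  The Hessian operator maps a tangent vector \<open>V\<close> to the covariant derivative, in direction \<open>V\<close>, of
  the gradient, for the Levi-Civita connection of the induced metric.
\<close>

definition hessian_operator ::
    "(real ^ 3) set \<Rightarrow> (real ^ 3 \<Rightarrow> real ^ 4) \<Rightarrow> (real ^ 3 \<Rightarrow> real) \<Rightarrow> real ^ 3 \<Rightarrow> real ^ 3 ^ 3" where
  "hessian_operator U X \<phi> u =
     (\<chi> i j. partial U j (\<lambda>v. gradient U X \<phi> v $ i) u +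
             (\<Sum>l\<in>UNIV. christoffel U X u i j l * gradient U X \<phi> u $ l))"

definition L_operator ::
    "nat \<Rightarrow> (real ^ 3) set \<Rightarrow> (real ^ 3 \<Rightarrow> real ^ 4) \<Rightarrow> (real ^ 3 \<Rightarrow> real ^ 4) \<Rightarrow>
     (real ^ 3 \<Rightarrow> real) \<Rightarrow> real ^ 3 \<Rightarrow> real" where
  "L_operator k U X N \<phi> u =
     trace (newton_transformation k (shape_operator U X N u) ** hessian_operator U X \<phi> u)"

definition L_operator_vec ::
    "nat \<Rightarrow> (real ^ 3) set \<Rightarrow> (real ^ 3 \<Rightarrow> real ^ 4) \<Rightarrow> (real ^ 3 \<Rightarrow> real ^ 4) \<Rightarrow>
     (real ^ 3 \<Rightarrow> real ^ 4) \<Rightarrow> real ^ 3 \<Rightarrow> real ^ 4" where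
  "L_operator_vec k U X N F u = (\<chi> a. L_operator k U X N (\<lambda>v. F v $ a) u)"

text \<open>The parameter \<open>u\<close> is \<open>(s, t, w)\<close>; \<open>cos t \<noteq> 0\<close> is where the parametrization is an immersion.\<close>

definition rot_domain :: "(real ^ 3) set" where
  "rot_domain = {u. u $ 1 \<noteq> 0 \<and> u $ 2 \<in> {0..2 * pi} \<and> u $ 3 \<in> {0..2 * pi} \<and> cos (u $ 2) \<noteq> 0}"

definition rot_hypersurface :: "real \<Rightarrow> real ^ 3 \<Rightarrow> real ^ 4" where
  "rot_hypersurface c u =
     (let s = u $ 1; t = u $ 2; w = u $ 3 in
        vector [c, - s * cos t * sin w, - s * sin t, s * cos t * cos w])"

end

theory Submission
  imports Defs
begin

text \<open>
  The hypersurface lies in the hyperplane \<open>x\<^sub>1 = c9\<close>, so a unit normal field takes values in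
  \<open>{e\<^sub>1, - e\<^sub>1}\<close> and, being continuous, is locally constant. Hence each component of it has
  vanishing gradient, so vanishing Hessian operator. The partial derivatives are determined because no point
  of the parameter domain is isolated along a coordinate line.
\<close>

text \<open>On a trivial filter every vector is a derivative, so \<open>partial\<close> would be an
  arbitrary choice there. This condition excludes that.\<close>

definition coordinatewise_nonisolated :: "(real ^ 3) set \<Rightarrow> bool" where
  "coordinatewise_nonisolated U \<longleftrightarrow>
     (\<forall>u\<in>U. \<forall>i. at 0 within {h. u + h *\<^sub>R axis i 1 \<in> U} \<noteq> bot)"

lemma partial_eqI:
  assumes "coordinatewise_nonisolated U" "u \<in> U"
    and "((\<lambda>h. f (u + h *\<^sub>R axis i 1)) has_vector_derivative D)
           (at 0 within {h. u + h *\<^sub>R axis i 1 \<in> U})"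
  shows "partial U i f u = D"
  using assms unfolding partial_def coordinatewise_nonisolated_def
  by (intro vector_derivative_within) auto

lemma partial_locally_constant:
  assumes U: "coordinatewise_nonisolated U" "u \<in> U"
    and ev: "\<forall>\<^sub>F v in at u within U. f v = f u"
  shows "partial U i f u = 0"
proof -
  obtain d where d: "d > 0" "\<And>v. v \<in> U \<Longrightarrow> dist v u < d \<Longrightarrow> f v = f u"
    using ev unfolding eventually_at by metis
  have "((\<lambda>h. f (u + h *\<^sub>R axis i 1)) has_vector_derivative 0)
           (at 0 within {h. u + h *\<^sub>R axis i 1 \<in> U})"
  \<comment> \<open>Moving by \<open>h\<close> along a unit vector covers distance
    \<open>\<bar>h\<bar>\<close>, so the radius \<open>d\<close> around \<open>u\<close> also serves
    as the radius for \<open>h\<close>.\<close>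
  proof (rule has_vector_derivative_transform_within[OF has_vector_derivative_const d(1)])
    show "0 \<in> {h. u + h *\<^sub>R axis i 1 \<in> U}"
      using U(2) by simp
    fix h assume "h \<in> {h. u + h *\<^sub>R axis i 1 \<in> U}" "dist h 0 < d"
    then show "f u = f (u + h *\<^sub>R axis i 1)"
      by (intro d(2)[symmetric]) (auto simp: dist_norm)
  qed
  then show ?thesis
    using U by (rule_tac partial_eqI)
qed

lemma gradient_locally_constant:
  assumes "coordinatewise_nonisolated U" "u \<in> U"
    and "\<forall>\<^sub>F v in at u within U. \<phi> v = \<phi> u"
  shows "gradient U X \<phi> u = 0"
  using partial_locally_constant[OF assms]
  by (simp add: gradient_def vec_eq_iff matrix_vector_mult_def)

text \<open>The Hessian differentiates the gradient once more, so local constancy is assumed at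
  every point of \<open>U\<close>: the gradient then vanishes on all of \<open>U\<close>, which
  kills both the derivative term and the Christoffel term.\<close>

lemma hessian_operator_locally_constant:
  assumes U: "coordinatewise_nonisolated U" "u \<in> U"
    and ev: "\<And>u. u \<in> U \<Longrightarrow> \<forall>\<^sub>F v in at u within U. \<phi> v = \<phi> u"
  shows "hessian_operator U X \<phi> u = 0"
proof -
  have grad: "gradient U X \<phi> v = 0" if "v \<in> U" for v
    using that gradient_locally_constant[OF U(1) that ev] by blast
  have "partial U j (\<lambda>v. gradient U X \<phi> v $ i) u = 0" for i j
    using U(2) grad
    by (intro partial_locally_constant[OF U]) (auto simp: eventually_at intro: exI[of _ 1])
  then show ?thesis
    using U(2) by (simp add: hessian_operator_def vec_eq_iff grad)
qed

text \<open>The Hessian operator of each component is 0, so the trace is that of a zero matrix,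
  whatever the Newton transformation is.\<close>

lemma L_operator_vec_locally_constant:
  assumes "coordinatewise_nonisolated U" "u \<in> U"
    and ev: "\<And>u. u \<in> U \<Longrightarrow> \<forall>\<^sub>F v in at u within U. F v = F u"
  shows "L_operator_vec k U X N F u = 0"
proof -
  have "hessian_operator U X (\<lambda>v. F v $ a) u = 0" for a
    by (rule hessian_operator_locally_constant[OF assms(1,2)]) (auto elim: eventually_mono[OF ev])
  then show ?thesis
    by (simp add: L_operator_vec_def L_operator_def vec_eq_iff trace_def matrix_matrix_mult_def)
qed

lemma coordinatewise_nonisolated_rot_domain: "coordinatewise_nonisolated rot_domain"
  unfolding coordinatewise_nonisolated_def
proof (intro ballI allI)
  fix u :: "real ^ 3" and i :: 3
  assume u: "u \<in> rot_domain"
  \<comment> \<open>The sign points inward: from a coordinate in \<open>{0..2 * pi}\<close>, a step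
    shorter than \<open>pi\<close> in this direction stays in the interval. For the first coordinate
    either sign would do, as \<open>s \<noteq> 0\<close> is an open condition.\<close>
  define \<sigma> :: real where "\<sigma> = (if u $ i < pi then 1 else -1)"
  let ?p = "\<lambda>h. u + (\<sigma> * h) *\<^sub>R axis i 1"
  have lim: "((\<lambda>h. ?p h $ j) \<longlongrightarrow> u $ j) (at_right 0)" for j
    by (auto intro!: tendsto_eq_intros)
  have "\<forall>\<^sub>F h in at_right 0. ?p h $ 1 \<noteq> 0"
    using u by (intro tendsto_imp_eventually_ne[OF lim]) (simp add: rot_domain_def)
  moreover have "\<forall>\<^sub>F h in at_right 0. cos (?p h $ 2) \<noteq> 0"
    using u by (intro tendsto_imp_eventually_ne[OF tendsto_cos[OF lim]]) (simp add: rot_domain_def)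
  moreover have "\<forall>\<^sub>F h in at_right 0. ?p h $ j \<in> {0..2*pi}" if j: "j \<in> {2, 3}" for j
  proof -
    have uj: "u $ j \<in> {0..2*pi}"
      using u j by (auto simp: rot_domain_def)
    have "\<forall>\<^sub>F h in at_right 0. h \<in> {0<..<pi}"
      by (intro eventually_at_right_real pi_gt_zero)
    then show ?thesis
      by eventually_elim (use uj in \<open>auto simp: \<sigma>_def axis_def\<close>)
  qed
  ultimately have ev: "\<forall>\<^sub>F h in at_right 0. ?p h \<in> rot_domain"
    unfolding rot_domain_def mem_Collect_eq by (intro eventually_conj) auto
  show "at 0 within {h. u + h *\<^sub>R axis i 1 \<in> rot_domain} \<noteq> bot"
    unfolding trivial_limit_within islimpt_approachable not_not
  proof (intro allI impI)
    fix e :: real assume "e > 0"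
    then have "\<forall>\<^sub>F h in at_right 0. h \<in> {0<..<e}"
      by (rule eventually_at_right_real)
    then have "\<forall>\<^sub>F h in at_right 0. h \<in> {0<..<e} \<and> ?p h \<in> rot_domain"
      using ev by (rule eventually_conj)
    then obtain h where "h \<in> {0<..<e}" "?p h \<in> rot_domain"
      using eventually_happens trivial_limit_at_right_real by blast
    then show "\<exists>h'\<in>{h. u + h *\<^sub>R axis i 1 \<in> rot_domain}. h' \<noteq> 0 \<and> dist h' 0 < e"
      by (intro bexI[of _ "\<sigma> * h"]) (auto simp: \<sigma>_def)
  qed
qed

lemma vector_4_nth [simp]:
  "(vector [a, b, c, d] :: 'a::zero ^ 4) $ 1 = a"
  "(vector [a, b, c, d] :: 'a::zero ^ 4) $ 2 = b"
  "(vector [a, b, c, d] :: 'a::zero ^ 4) $ 3 = c"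
  "(vector [a, b, c, d] :: 'a::zero ^ 4) $ 4 = d"
  unfolding vector_def by auto

lemma has_vector_derivative_vector_4:
  fixes a b c d :: "real \<Rightarrow> real"
  assumes "(a has_real_derivative a') (at x within S)" "(b has_real_derivative b') (at x within S)"
    "(c has_real_derivative c') (at x within S)" "(d has_real_derivative d') (at x within S)"
  shows "((\<lambda>h. vector [a h, b h, c h, d h] :: real ^ 4) has_vector_derivative
           vector [a', b', c', d']) (at x within S)"
proof -
  have vec: "vector [p, q, r, s] =
      p *\<^sub>R axis 1 1 + q *\<^sub>R axis 2 1 + r *\<^sub>R axis 3 1 + s *\<^sub>R (axis 4 1 :: real ^ 4)"
    for p q r s
    by (simp add: vec_eq_iff forall_4 axis_def)
  show ?thesis
    unfolding vec
    by (intro has_vector_derivative_add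
        has_vector_derivative_scaleR[OF _ has_vector_derivative_const, simplified] assms)
qed

text \<open>Since \<open>partial_eqI\<close> works with derivatives within a set, the usual formulas
  also hold on the boundary of the parameter domain.\<close>

lemma partial_rot_hypersurface:
  fixes c :: real and u :: "real ^ 3"
  defines "s \<equiv> u $ 1" and "t \<equiv> u $ 2" and "w \<equiv> u $ 3"
  assumes u: "u \<in> rot_domain"
  shows "partial rot_domain 1 (rot_hypersurface c) u =
           vector [0, - cos t * sin w, - sin t, cos t * cos w]"
    and "partial rot_domain 2 (rot_hypersurface c) u =
           vector [0, s * sin t * sin w, - s * cos t, - s * sin t * cos w]"
    and "partial rot_domain 3 (rot_hypersurface c) u =
           vector [0, - s * cos t * cos w, 0, - s * cos t * sin w]"
  unfolding s_def t_def w_def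
  by - ((rule partial_eqI[OF coordinatewise_nonisolated_rot_domain u],
      simp add: rot_hypersurface_def axis_def Let_def,
      rule has_vector_derivative_vector_4;
      auto intro!: derivative_eq_intros)+)

lemma rot_hypersurface_differentiable: "rot_hypersurface c differentiable (at u within U)"
proof -
  note D = bounded_linear_imp_has_derivative[OF bounded_linear_vec_nth]
  have nth: "(\<lambda>u. u $ i) differentiable (at u within U)" for i
    by (rule differentiableI[OF D])
  have sin: "(\<lambda>u. sin (u $ i)) differentiable (at u within U)" for i
    by (rule differentiableI[OF has_derivative_sin[OF D]])
  have cos: "(\<lambda>u. cos (u $ i)) differentiable (at u within U)" for i
    by (rule differentiableI[OF has_derivative_cos[OF D]])
  have eq: "rot_hypersurface c = (\<lambda>u. c *\<^sub>R axis 1 1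
      + (- (u $ 1) * cos (u $ 2) * sin (u $ 3)) *\<^sub>R axis 2 1
      + (- (u $ 1) * sin (u $ 2)) *\<^sub>R axis 3 1
      + (u $ 1 * cos (u $ 2) * cos (u $ 3)) *\<^sub>R axis 4 1)"
    by (simp add: fun_eq_iff rot_hypersurface_def Let_def vec_eq_iff forall_4 axis_def)
  show ?thesis
    unfolding eq
    by (intro differentiable_add differentiable_scaleR differentiable_mult differentiable_minus
        differentiable_const sin cos nth)
qed

lemma nondegenerate_immersion_rot_hypersurface:
  "nondegenerate_immersion rot_domain (rot_hypersurface c)"
  unfolding nondegenerate_immersion_def
proof (intro ballI conjI)
  fix u assume u: "u \<in> rot_domain"
  show "rot_hypersurface c differentiable (at u within rot_domain)"
    by (rule rot_hypersurface_differentiable)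
  define s t w where "s = u $ 1" "t = u $ 2" "w = u $ 3"
  note stw = this
  note [simp] = partial_rot_hypersurface[OF u, folded stw]
  \<comment> \<open>These are spherical coordinates of a Euclidean hyperplane: the Gram matrix is
    diagonal with entries 1, \<open>s\<^sup>2\<close> and
    \<open>s\<^sup>2 * (cos t)\<^sup>2\<close>.\<close>
  have "det (induced_metric rot_domain (rot_hypersurface c) u) = s ^ 4 * (cos t)\<^sup>2"
    by (simp add: induced_metric_def det_3 lorentz_def)
      (use sin_cos_squared_add[of t] sin_cos_squared_add[of w] in algebra)
  then show "invertible (induced_metric rot_domain (rot_hypersurface c) u)"
    using u by (simp add: invertible_det_nz rot_domain_def stw)
qed

lemma normal_rot_hypersurface:
  assumes N: "unit_normal_field rot_domain (rot_hypersurface c) N" and u: "u \<in> rot_domain"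
  shows "N u = axis 1 1 \<or> N u = - axis 1 1"
proof -
  define s t w where "s = u $ 1" "t = u $ 2" "w = u $ 3"
  note stw = this
  have nz: "s \<noteq> 0" "cos t \<noteq> 0"
    using u by (auto simp: rot_domain_def stw)
  have orth: "lorentz (N u) (partial rot_domain i (rot_hypersurface c) u) = 0" for i
    using N u by (auto simp: unit_normal_field_def)
  \<comment> \<open>Up to the nonzero factors 1, \<open>s\<close> and \<open>- s * cos t\<close>,
    these are the products of \<open>N u\<close> with the coordinate tangent vectors, hence the
    components of its spatial part in an orthonormal frame.\<close>
  define p where "p = - (N u $ 2) * cos t * sin w - N u $ 3 * sin t + N u $ 4 * cos t * cos w"
  define q where "q = N u $ 2 * sin t * sin w - N u $ 3 * cos t - N u $ 4 * sin t * cos w"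
  define r where "r = N u $ 2 * cos w + N u $ 4 * sin w"
  have "p = 0"
    using orth[of 1] by (simp add: partial_rot_hypersurface[OF u] lorentz_def p_def stw algebra_simps)
  have "s * q = 0"
    using orth[of 2] by (simp add: partial_rot_hypersurface[OF u] lorentz_def q_def stw algebra_simps)
  then have "q = 0"
    using nz by simp
  have "s * cos t * r = 0"
    using orth[of 3] by (simp add: partial_rot_hypersurface[OF u] lorentz_def r_def stw algebra_simps)
  then have "r = 0"
    using nz by simp
  \<comment> \<open>The frame is orthonormal, so the transposed matrix recovers the spatial entries
    of \<open>N u\<close> from \<open>p\<close>, \<open>q\<close>, \<open>r\<close>.\<close>
  have "N u $ 3 = - (p * sin t + q * cos t)"
    using sin_cos_squared_add[of t] unfolding p_def q_def by algebra
  moreover have "N u $ 2 = r * cos w - (p * cos t - q * sin t) * sin w"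
    using sin_cos_squared_add[of t] sin_cos_squared_add[of w] unfolding p_def q_def r_def by algebra
  moreover have "N u $ 4 = r * sin w + (p * cos t - q * sin t) * cos w"
    using sin_cos_squared_add[of t] sin_cos_squared_add[of w] unfolding p_def q_def r_def by algebra
  ultimately have zero: "N u $ 2 = 0" "N u $ 3 = 0" "N u $ 4 = 0"
    using \<open>p = 0\<close> \<open>q = 0\<close> \<open>r = 0\<close> by simp_all
  have "lorentz (N u) (N u) \<in> {1, -1}"
    using N u unfolding unit_normal_field_def by blast
  \<comment> \<open>A multiple of the time axis has Lorentz square \<le> 0, so the value 1 is
    impossible and the normal is timelike.\<close>
  then have "N u $ 1 * N u $ 1 = 1"
    using zero by (auto simp: lorentz_def) (smt (verit) zero_le_square)
  then have "N u $ 1 = 1 \<or> N u $ 1 = - 1"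
    using square_eq_1_iff by blast
  then show ?thesis
    using zero by (auto simp: vec_eq_iff forall_4 axis_def)
qed

text \<open>The witness shows that the claim about all unit normal fields is not vacuous.\<close>

lemma unit_normal_field_rot_hypersurface:
  "unit_normal_field rot_domain (rot_hypersurface c) (\<lambda>u. axis 1 1)"
  unfolding unit_normal_field_def
proof (intro conjI ballI allI)
  show "\<exists>\<epsilon>\<in>{1, -1}. \<forall>u\<in>rot_domain. lorentz (axis 1 1) (axis 1 1) = \<epsilon>"
    by (simp add: lorentz_def axis_def)
  fix u and i :: 3 assume "u \<in> rot_domain"
  then show "lorentz (axis 1 1) (partial rot_domain i (rot_hypersurface c) u) = 0"
    using exhaust_3[of i] by (auto simp: lorentz_def axis_def partial_rot_hypersurface)
qed auto

text \<open>Only local constancy can be expected: \<open>s \<noteq> 0\<close> and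
  \<open>cos t \<noteq> 0\<close> disconnect the domain, and the sign of \<open>N\<close> may differ
  between components.\<close>

lemma normal_locally_constant:
  assumes N: "unit_normal_field rot_domain (rot_hypersurface c) N" and u: "u \<in> rot_domain"
  shows "\<forall>\<^sub>F v in at u within rot_domain. N v = N u"
proof -
  have "(N \<longlongrightarrow> N u) (at u within rot_domain)"
    using N u by (simp add: unit_normal_field_def continuous_on)
  then have "((\<lambda>v. N v $ 1) \<longlongrightarrow> N u $ 1) (at u within rot_domain)"
    by (rule tendsto_vec_nth)
  \<comment> \<open>The first entry takes only the values 1 and -1, which are 2 apart, so a distance
    below 1 forces equality.\<close>
  then have "\<forall>\<^sub>F v in at u within rot_domain. dist (N v $ 1) (N u $ 1) < 1"
    by (rule tendstoD) simp
  moreover have "\<forall>\<^sub>F v in at u within rot_domain. v \<in> rot_domain"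
    by (simp add: eventually_at_filter)
  ultimately show ?thesis
  proof eventually_elim
    case (elim v)
    then show ?case
      using normal_rot_hypersurface[OF N u] normal_rot_hypersurface[OF N elim(2)]
      by (auto simp: dist_real_def)
  qed
qed

theorem theorem5:
  fixes c9 :: real
  shows "nondegenerate_immersion rot_domain (rot_hypersurface c9) \<and>
    (\<exists>N. unit_normal_field rot_domain (rot_hypersurface c9) N) \<and>
    (\<forall>N. unit_normal_field rot_domain (rot_hypersurface c9) N \<longrightarrow>
      (\<forall>u\<in>rot_domain. L_operator_vec 1 rot_domain (rot_hypersurface c9) N N u = 0))"
  \<comment> \<open>The vanishing lemma is applied with \<open>F\<close> equal to \<open>N\<close>
    and with \<open>k = 1\<close>.\<close>
  using nondegenerate_immersion_rot_hypersurface unit_normal_field_rot_hypersurface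
    L_operator_vec_locally_constant[OF coordinatewise_nonisolated_rot_domain]
    normal_locally_constant
  by metis

end
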